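(* Let $X\neq\{0\}$ be a real Hilbert space, let $m\in\mathbb{N}$, let $I:=\{1,2,\ldots,m\}$, and let $\lambda\in(0,2)$. Let $\mathcal{A}:=(A_i)_{i=1}^m$ be an innately regular family of $m$ closed affine subspaces of $X$, and let $\mu_{\mathcal{A},\lambda}>0$ be the Bauschke-Tung constant associated with $\mathcal{A}$ and $\lambda$ (see context). For each $k\in\mathbb{N}\cup\{0\}$ let $\lambda_k\in[0,\lambda]$, let $c:\mathbb{N}\cup\{0\}\to I$ be an arbitrary function, and let $T_k:X\to X$ be defined by $T_k(x):=(1-\lambda_k)x+\lambda_k P_{A_{c(k)}}(x)$ for all $x\in X$. Let $(e^k)_{k=0}^\infty$ be any sequence of vectors in $X$, let $x^0\in X$, and define $$x^{k+1}:=T_k(x^k)+e^k\qquad\text{for all } k\in\mathbb{N}\cup\{0\}.$$ Then $$\|x^k\|\le\|x^0\|+\lambda\mu_{\mathcal{A},\lambda}+\sum_{j=0}^\infty\|e^j\|\qquad\text{for every } k\in\mathbb{N}\cup\{0\},$$ where the right-hand side is understood as $+\infty$ if the series diverges.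
   Context: $\mathbb{N}$ denotes the positive integers. For a nonempty closed convex set $C\subseteq X$, $P_C:X\to X$ is the orthogonal (nearest point) projection onto $C$, and $\mathrm{Id}$ is the identity map. For $x\in X$ and $A\subseteq X$, $d(x,A):=\inf\{\|x-a\|\,:\,a\in A\}$. An affine subspace is a set $A=p_A+\widetilde{A}$ with $p_A\in X$ and $\widetilde{A}$ a linear subspace of $X$ (the associated linear subspace). A finite family $(L_i)_{i\in J}$ of closed linear subspaces is regular if there is $\eta>0$ such that $d(x,\bigcap_{i\in J}L_i)\le\eta\max\{d(x,L_i)\,:\,i\in J\}$ for all $x\in X$; it is innately regular if every nonempty subfamily of it is regular. A finite family $(A_i)_{i=1}^m$ of closed affine subspaces is innately regular if the family $(\widetilde{A}_i)_{i=1}^m$ of associated closed linear subspaces is innately regular. Bauschke-Tung constant: let $\mathcal{R}_{\mathcal{A},\lambda}:=\{S:X\to X\,:\,S=(1-\tau)\mathrm{Id}+\tau P_{A},\ \tau\in[0,\lambda],\ A\in\{A_i\,:\,i\in I\}\}$. A known theorem of Bauschke and Tung states that, for $\mathcal{A}$ innately regular and $\lambda\in(0,2)$, there is a constant $\mu_{\mathcal{A},\lambda}>0$, depending only on $\mathcal{A}$ and $\lambda$, such that for all $k\in\mathbb{N}$, all $x^0\in X$ and all $S_{k-1},\ldots,S_0\in\mathcal{R}_{\mathcal{A},\lambda}$ one has $\|S_{k-1}S_{k-2}\cdots S_0(x^0)\|\le\|x^0\|+\lambda\mu_{\mathcal{A},\lambda}$. Throughout, $\mu_{\mathcal{A},\lambda}$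 denotes a constant with this property. *)

theory Defs
  imports "HOL-Analysis.Analysis"
begin

text \<open>Hilbert spaces are types of sort \<open>{real_inner, complete_space}\<close>.  The library's
  \<open>closest_point\<close> is not available there, as it requires the sort \<open>heine_borel\<close>.\<close>

definition nearest_point_proj :: "'a::real_inner set \<Rightarrow> 'a \<Rightarrow> 'a" where
  "nearest_point_proj C x = (THE p. p \<in> C \<and> (\<forall>y\<in>C. dist x p \<le> dist x y))"

text \<open>\<open>affine_parallel L A\<close> means that \<open>A = p + L\<close> for some \<open>p\<close>.  The library's predicate
  \<open>affine\<close> also holds for the empty set, so affine subspaces are the nonempty affine sets.\<close>

definition assoc_subspace :: "'a::real_vector set \<Rightarrow> 'a set" where
  "assoc_subspace A = (THE L. subspace L \<and> affine_parallel L A)"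

lemma affine_subspace_iff:
  "affine A \<and> A \<noteq> {} \<longleftrightarrow> (\<exists>p L. subspace L \<and> A = (\<lambda>x. p + x) ` L)"
proof
  assume "affine A \<and> A \<noteq> {}"
  then obtain L where "subspace L" "affine_parallel A L"
    using affine_parallel_subspace[of A] by auto
  from affine_parallel_commute[OF this(2)] obtain p where "A = (\<lambda>x. p + x) ` L"
    by (auto simp: affine_parallel_def)
  then show "\<exists>p L. subspace L \<and> A = (\<lambda>x. p + x) ` L"
    using \<open>subspace L\<close> by auto
next
  assume "\<exists>p L. subspace L \<and> A = (\<lambda>x. p + x) ` L"
  then obtain p L where L: "subspace L" "A = (\<lambda>x. p + x) ` L" by auto
  then show "affine A \<and> A \<noteq> {}"
    using subspace_imp_affine[OF L(1)] subspace_0[OF L(1)] affine_translation[of L p] by auto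
qed

lemma assoc_subspace_eq:
  assumes "subspace L"
  shows "assoc_subspace ((\<lambda>x. p + x) ` L) = L"
  unfolding assoc_subspace_def
proof (rule the_equality)
  show "subspace L \<and> affine_parallel L ((\<lambda>x. p + x) ` L)"
    using assms by (auto simp: affine_parallel_def)
next
  fix M assume M: "subspace M \<and> affine_parallel M ((\<lambda>x. p + x) ` L)"
  have "affine_parallel L ((\<lambda>x. p + x) ` L)" by (auto simp: affine_parallel_def)
  then have "affine_parallel M L"
    using M affine_parallel_assoc affine_parallel_commute by metis
  then show "M = L" using M assms parallel_subspace[of M L] by simp
qed

text \<open>The next two notions are meant for finite nonempty \<open>J\<close>.\<close>

definition regular_family :: "'i set \<Rightarrow> ('i \<Rightarrow> 'a::real_normed_vector set) \<Rightarrow> bool" where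
  "regular_family J L \<longleftrightarrow>
     (\<exists>\<eta>>0. \<forall>x. infdist x (\<Inter>i\<in>J. L i) \<le> \<eta> * Max ((\<lambda>i. infdist x (L i)) ` J))"

definition innately_regular :: "'i set \<Rightarrow> ('i \<Rightarrow> 'a::real_normed_vector set) \<Rightarrow> bool" where
  "innately_regular J L \<longleftrightarrow> (\<forall>K. K \<subseteq> J \<and> K \<noteq> {} \<longrightarrow> regular_family K L)"

definition innately_regular_affine :: "'i set \<Rightarrow> ('i \<Rightarrow> 'a::real_normed_vector set) \<Rightarrow> bool" where
  "innately_regular_affine J A \<longleftrightarrow> innately_regular J (\<lambda>i. assoc_subspace (A i))"

definition relaxed_projections :: "'i set \<Rightarrow> ('i \<Rightarrow> 'a::real_inner set) \<Rightarrow> real \<Rightarrow> ('a \<Rightarrow> 'a) set" where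
  "relaxed_projections J A lam =
     {S. \<exists>\<tau>\<in>{0..lam}. \<exists>i\<in>J. S = (\<lambda>x. (1 - \<tau>) *\<^sub>R x + \<tau> *\<^sub>R nearest_point_proj (A i) x)}"

text \<open>\<open>fold S [0..<k] x0\<close> is \<open>S (k - 1) (\<dots> (S 1 (S 0 x0)))\<close>.\<close>

definition bauschke_tung_constant ::
    "'i set \<Rightarrow> ('i \<Rightarrow> 'a::real_inner set) \<Rightarrow> real \<Rightarrow> real \<Rightarrow> bool" where
  "bauschke_tung_constant J A lam \<mu> \<longleftrightarrow>
     \<mu> > 0 \<and>
     (\<forall>k\<ge>1. \<forall>x0. \<forall>S :: nat \<Rightarrow> 'a \<Rightarrow> 'a. (\<forall>i<k. S i \<in> relaxed_projections J A lam) \<longrightarrow>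
        norm (fold S [0..<k] x0) \<le> norm x0 + lam * \<mu>)"

end

theory Submission
  imports Defs
begin

text \<open>Projections onto closed convex sets of a Hilbert space are firmly nonexpansive, so every
  relaxed projection with parameter in \<open>[0,2]\<close> is nonexpansive. Hence the inexact orbit and the
  exact orbit started at the same point drift apart by at most \<open>\<parallel>e j\<parallel>\<close> in step \<open>j\<close>, while the
  norm of the exact orbit is bounded by the Bauschke-Tung property.\<close>

text \<open>Minimising sequence argument: by the parallelogram law, points of \<open>C\<close> whose
  distances to \<open>x\<close> approach the infimum form a Cauchy sequence. Completeness provides
  the limit and closedness keeps it in \<open>C\<close>.\<close>

lemma nearest_point_exists:
  fixes C :: "'a::{real_inner, complete_space} set"
  assumes "closed C" "convex C" "C \<noteq> {}"
  obtains p where "p \<in> C" "\<And>y. y \<in> C \<Longrightarrow> dist x p \<le> dist x y"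
proof -
  define d where "d = infdist x C"
  \<comment> \<open>The excess over the infimum is measured on squares, since the parallelogram law
    is quadratic.\<close>
  have "\<exists>y\<in>C. (dist x y)\<^sup>2 < d\<^sup>2 + inverse (real (Suc n))" for n
  proof -
    have "d < sqrt (d\<^sup>2 + inverse (real (Suc n)))"
      by (rule real_less_rsqrt) simp
    then have "(INF y\<in>C. dist x y) < sqrt (d\<^sup>2 + inverse (real (Suc n)))"
      using assms(3) by (simp add: d_def infdist_notempty)
    then obtain y where "y \<in> C" and y: "dist x y < sqrt (d\<^sup>2 + inverse (real (Suc n)))"
      using assms(3) by (auto simp: cINF_less_iff)
    have "(dist x y)\<^sup>2 < (sqrt (d\<^sup>2 + inverse (real (Suc n))))\<^sup>2"
      using y by (intro power_strict_mono) auto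
    then show ?thesis
      using \<open>y \<in> C\<close> by (auto simp: real_sqrt_pow2)
  qed
  then obtain y where yC: "\<And>n. y n \<in> C"
    and y: "\<And>n. (dist x (y n))\<^sup>2 < d\<^sup>2 + inverse (real (Suc n))"
    by metis
  have gap: "(dist (y i) (y j))\<^sup>2 \<le> 2 * inverse (real (Suc i)) + 2 * inverse (real (Suc j))" for i j
  proof -
    let ?mid = "(1/2) *\<^sub>R y i + (1/2) *\<^sub>R y j"
    have "?mid \<in> C"
      using convexD[OF assms(2) yC yC, of "1/2" "1/2" i j] by simp
    then have "d\<^sup>2 \<le> (dist x ?mid)\<^sup>2"
      unfolding d_def by (intro power_mono infdist_le infdist_nonneg)
    \<comment> \<open>Parallelogram law for \<open>x - y i\<close> and \<open>x - y j\<close>. The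
      midpoint is at distance at least \<open>d\<close>, so the \<open>d\<^sup>2\<close> terms
      cancel and only the excesses remain.\<close>
    moreover have "(dist (y i) (y j))\<^sup>2
        = 2 * (dist x (y i))\<^sup>2 + 2 * (dist x (y j))\<^sup>2 - 4 * (dist x ?mid)\<^sup>2"
      unfolding dist_norm power2_norm_eq_inner
      by (simp add: inner_simps inner_commute algebra_simps)
    ultimately show ?thesis
      using y[of i] y[of j] by linarith
  qed
  have "Cauchy y"
  proof (rule metric_CauchyI)
    fix r :: real assume "r > 0"
    \<comment> \<open>For \<open>i, j \<ge> N\<close> the bound \<open>gap\<close> is at most
      \<open>4 * inverse (real (Suc N))\<close>, hence the quarter.\<close>
    then obtain N where N: "inverse (real (Suc N)) < r\<^sup>2 / 4"
      using reals_Archimedean[of "r\<^sup>2 / 4"] by auto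
    have "dist (y i) (y j) < r" if "i \<ge> N" "j \<ge> N" for i j
    proof -
      have "inverse (real (Suc i)) \<le> inverse (real (Suc N))"
        "inverse (real (Suc j)) \<le> inverse (real (Suc N))"
        using that by (auto intro!: le_imp_inverse_le)
      then have "(dist (y i) (y j))\<^sup>2 < r\<^sup>2"
        using gap[of i j] N by linarith
      then show ?thesis
        using \<open>r > 0\<close> by (simp add: power2_less_imp_less)
    qed
    then show "\<exists>N. \<forall>i\<ge>N. \<forall>j\<ge>N. dist (y i) (y j) < r" by blast
  qed
  then obtain p where p: "y \<longlonglongrightarrow> p"
    using Cauchy_convergent convergent_def by blast
  have "p \<in> C"
    using assms(1) yC p closed_sequentially by blast
  have "(dist x p)\<^sup>2 \<le> d\<^sup>2"
  proof (rule LIMSEQ_le)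
    show "(\<lambda>n. (dist x (y n))\<^sup>2) \<longlonglongrightarrow> (dist x p)\<^sup>2"
      by (intro tendsto_intros p)
    show "(\<lambda>n. d\<^sup>2 + inverse (real (Suc n))) \<longlonglongrightarrow> d\<^sup>2"
      using tendsto_add[OF tendsto_const LIMSEQ_inverse_real_of_nat, of "d\<^sup>2"] by simp
    show "\<exists>N. \<forall>n\<ge>N. (dist x (y n))\<^sup>2 \<le> d\<^sup>2 + inverse (real (Suc n))"
      using y less_imp_le by blast
  qed
  then have "dist x p \<le> d"
    by (rule power2_le_imp_le) (simp add: d_def infdist_nonneg)
  then have "dist x p \<le> dist x z" if "z \<in> C" for z
    using infdist_le[OF that, of x] by (simp add: d_def)
  with \<open>p \<in> C\<close> show thesis by (rule that)
qed

text \<open>Existence together with uniqueness, which convexity gives, makes the definite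
  description meaningful.\<close>

lemma nearest_point_proj_nearest:
  fixes C :: "'a::{real_inner, complete_space} set"
  assumes "closed C" "convex C" "C \<noteq> {}"
  shows "nearest_point_proj C x \<in> C \<and> (\<forall>y\<in>C. dist x (nearest_point_proj C x) \<le> dist x y)"
  unfolding nearest_point_proj_def
proof (rule theI')
  show "\<exists>!p. p \<in> C \<and> (\<forall>y\<in>C. dist x p \<le> dist x y)"
    using nearest_point_exists[OF assms, of x] any_closest_point_unique[OF assms(2,1)] by metis
qed

lemma nearest_point_proj_firmly_nonexpansive:
  fixes C :: "'a::{real_inner, complete_space} set"
  assumes "closed C" "convex C" "C \<noteq> {}"
  shows "(norm (nearest_point_proj C x - nearest_point_proj C y))\<^sup>2
    \<le> inner (x - y) (nearest_point_proj C x - nearest_point_proj C y)"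
proof -
  let ?P = "nearest_point_proj C"
  note P = nearest_point_proj_nearest[OF assms]
  \<comment> \<open>Variational characterisation of the nearest point, applied at \<open>x\<close>
    with test point \<open>?P y\<close> and at \<open>y\<close> with test point \<open>?P x\<close>.
    The sum of the two inequalities is the claim.\<close>
  have "inner (x - ?P x) (?P y - ?P x) \<le> 0" "inner (y - ?P y) (?P x - ?P y) \<le> 0"
    using P by (auto intro!: any_closest_point_dot[OF assms(2,1)])
  then show ?thesis
    by (simp add: power2_norm_eq_inner inner_simps inner_commute algebra_simps)
qed

lemma relaxed_projection_nonexpansive:
  fixes C :: "'a::{real_inner, complete_space} set"
  assumes "closed C" "convex C" "C \<noteq> {}" "0 \<le> \<tau>" "\<tau> \<le> 2"
  shows "norm (((1 - \<tau>) *\<^sub>R x + \<tau> *\<^sub>R nearest_point_proj C x)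
    - ((1 - \<tau>) *\<^sub>R y + \<tau> *\<^sub>R nearest_point_proj C y)) \<le> norm (x - y)"
proof -
  define u where "u = x - y"
  define v where "v = nearest_point_proj C x - nearest_point_proj C y"
  have "inner v v \<le> inner u v"
    using nearest_point_proj_firmly_nonexpansive[OF assms(1-3), of x y]
    by (simp add: u_def v_def power2_norm_eq_inner)
  then have "0 \<le> (2 * \<tau>) * (inner u v - inner v v)"
    using assms(4) by simp
  moreover have "0 \<le> \<tau> * (2 - \<tau>) * inner (u - v) (u - v)"
    using assms(4,5) by simp
  \<comment> \<open>Both subtracted terms are nonnegative: the first because
    \<open>0 \<le> \<tau> \<le> 2\<close>, the second by firm nonexpansiveness.\<close>
  moreover have "(norm ((1 - \<tau>) *\<^sub>R u + \<tau> *\<^sub>R v))\<^sup>2 = (norm u)\<^sup>2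
      - \<tau> * (2 - \<tau>) * inner (u - v) (u - v) - (2 * \<tau>) * (inner u v - inner v v)"
    unfolding power2_norm_eq_inner
    by (simp add: inner_simps inner_commute algebra_simps)
  ultimately have "(norm ((1 - \<tau>) *\<^sub>R u + \<tau> *\<^sub>R v))\<^sup>2 \<le> (norm u)\<^sup>2"
    by linarith
  then have "norm ((1 - \<tau>) *\<^sub>R u + \<tau> *\<^sub>R v) \<le> norm u"
    by (rule power2_le_imp_le) simp
  then show ?thesis
    by (simp add: u_def v_def algebra_simps)
qed

lemma perturbed_orbit_deviation:
  fixes x e :: "nat \<Rightarrow> 'a::real_normed_vector"
  assumes "\<And>k y z. norm (T k y - T k z) \<le> norm (y - z)"
    and "\<And>k. x (Suc k) = T k (x k) + e k"
  shows "norm (x k - fold T [0..<k] (x 0)) \<le> (\<Sum>j<k. norm (e j))"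
proof (induction k)
  case (Suc k)
  let ?y = "fold T [0..<k] (x 0)"
  \<comment> \<open>The list \<open>[0..<Suc k]\<close> ends in \<open>k\<close>, so
    \<open>fold\<close> applies \<open>T k\<close> last and both orbits take this step with the same
    operator.\<close>
  have "x (Suc k) - fold T [0..<Suc k] (x 0) = (T k (x k) - T k ?y) + e k"
    by (simp add: assms(2))
  then have "norm (x (Suc k) - fold T [0..<Suc k] (x 0)) \<le> norm (T k (x k) - T k ?y) + norm (e k)"
    by (simp only: norm_triangle_ineq)
  then show ?case
    using assms(1)[of k "x k" ?y] Suc.IH by simp
qed simp

theorem theorem3:
  fixes m :: nat
    and A :: "nat \<Rightarrow> 'a::{real_inner, complete_space} set"
    and lam \<mu> :: real
    and lams :: "nat \<Rightarrow> real"
    and c :: "nat \<Rightarrow> nat"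
    and T :: "nat \<Rightarrow> 'a \<Rightarrow> 'a"
    and e x :: "nat \<Rightarrow> 'a"
    and x0 :: 'a
  assumes "(UNIV :: 'a set) \<noteq> {0}"
    and "m \<ge> 1"
    and "0 < lam" and "lam < 2"
    and "\<And>i. i \<in> {1..m} \<Longrightarrow> closed (A i) \<and> affine (A i) \<and> A i \<noteq> {}"
    and "innately_regular_affine {1..m} A"
    and "bauschke_tung_constant {1..m} A lam \<mu>"
    and "\<And>k. lams k \<in> {0..lam}"
    and "\<And>k. c k \<in> {1..m}"
    and "\<And>k z. T k z = (1 - lams k) *\<^sub>R z + lams k *\<^sub>R nearest_point_proj (A (c k)) z"
    and "x 0 = x0"
    and "\<And>k. x (Suc k) = T k (x k) + e k"
  shows "\<forall>k. ereal (norm (x k)) \<le> ereal (norm x0) + ereal (lam * \<mu>) + (\<Sum>j. ereal (norm (e j)))"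
proof
  fix k
  have "convex (A (c j))" "closed (A (c j))" "A (c j) \<noteq> {}" for j
    using assms(5)[OF assms(9)] by (auto intro: affine_imp_convex)
  moreover have "0 \<le> lams j" "lams j \<le> 2" for j
    using assms(4) assms(8)[of j] by auto
  ultimately have "norm (T j y - T j z) \<le> norm (y - z)" for j y z
    unfolding assms(10) by (intro relaxed_projection_nonexpansive)
  then have dev: "norm (x k - fold T [0..<k] x0) \<le> (\<Sum>j<k. norm (e j))"
    using perturbed_orbit_deviation[of T x e k] assms(11,12) by simp
  have rel: "T j \<in> relaxed_projections {1..m} A lam" for j
    unfolding relaxed_projections_def using assms(8-10) by blast
  have "norm (fold T [0..<k] x0) \<le> norm x0 + lam * \<mu>"
  \<comment> \<open>The Bauschke-Tung property speaks only of products with at least one factor. For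
    the empty product the bound holds because \<open>lam * \<mu>\<close> is positive.\<close>
  proof (cases "k = 0")
    case True
    then show ?thesis
      using assms(3,7) by (simp add: bauschke_tung_constant_def)
  next
    case False
    then show ?thesis
      using assms(7) rel unfolding bauschke_tung_constant_def by simp
  qed
  then have "norm (x k) \<le> norm x0 + lam * \<mu> + (\<Sum>j<k. norm (e j))"
    using dev norm_triangle_sub[of "x k" "fold T [0..<k] x0"] by linarith
  then have "ereal (norm (x k)) \<le> ereal (norm x0) + ereal (lam * \<mu>) + (\<Sum>j<k. ereal (norm (e j)))"
    by simp
  \<comment> \<open>Partial sums of nonnegative terms lie below the series, whose value in
    \<open>ereal\<close> is infinite in the divergent case, so both cases are covered at
    once.\<close>
  also have "\<dots> \<le> ereal (norm x0) + ereal (lam * \<mu>) + (\<Sum>j. ereal (norm (e j)))"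
    by (intro add_left_mono suminf_upper) simp
  finally show "ereal (norm (x k))
    \<le> ereal (norm x0) + ereal (lam * \<mu>) + (\<Sum>j. ereal (norm (e j)))" .
qed

end
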